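(* Let $r>0$, let $f\in C^1(\mathbb B_r)$ with $\mathbb B_r=\{x\in\mathbb{R}^d:\|x\|\le r\}$, and let $x^{(1)},\dots,x^{(N)}\in\mathbb B_r$ be such that the columns of $$B:=\big(\nabla f(x^{(1)}),\dots,\nabla f(x^{(N)})\big)\in\mathbb{R}^{d\times N}$$ span $V_{\nabla f}:=\operatorname{span}\{\nabla f(x):x\in\mathbb B_r\}$. Then every left singular matrix $U\in O(d)$ of $B$ satisfies $$U\in\operatorname*{argmin}_{W\in O(d)}|\mathcal V(f_W)| .$$
   Context: $O(d)$ is the group of orthogonal $d\times d$ matrices. For $W\in O(d)$, $f_W:=f(W\,\cdot):\mathbb B_r\to\mathbb{R}$. $\mathcal V(f_W)=\{i\in\{1,\dots,d\}:\partial_{x_i}f_W\ne0\}$, where $\neq 0$ means not identically zero on $\mathbb B_r$. A left singular matrix of $B$ is the matrix $U\in O(d)$ in a full singular value decomposition $B=U\Sigma W^{\mathrm T}$ with $W\in O(N)$ and $\Sigma\in\mathbb{R}^{d\times N}$ rectangular diagonal with nonnegative entries. *)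

theory Defs
  imports "HOL-Analysis.Analysis"
begin

text \<open>
  Derivatives on the closed ball are taken relative to the ball
  (\<open>at x within S\<close>). For \<open>S = cball 0 r\<close> with \<open>r > 0\<close> this derivative is unique at every point,
  agrees with the ordinary one in the interior, and at boundary points is the value of the
  continuous extension of the interior derivative whenever \<open>f\<close> is \<open>C\<^sup>1\<close>. It depends only on the
  values of \<open>f\<close> on \<open>S\<close>, so a total function stands for its restriction to \<open>S\<close>.
\<close>

definition partial_on :: "(real^'d) set \<Rightarrow> 'd \<Rightarrow> (real^'d \<Rightarrow> real) \<Rightarrow> real^'d \<Rightarrow> real" where
  "partial_on S i f x = frechet_derivative f (at x within S) (axis i 1)"

definition grad_on :: "(real^'d) set \<Rightarrow> (real^'d \<Rightarrow> real) \<Rightarrow> real^'d \<Rightarrow> real^'d" where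
  "grad_on S f x = (\<chi> i. partial_on S i f x)"

definition C1_on :: "(real^'d) set \<Rightarrow> (real^'d \<Rightarrow> real) \<Rightarrow> bool" where
  "C1_on S f \<longleftrightarrow> f differentiable_on S \<and> continuous_on S (grad_on S f)"

definition grad_space :: "real \<Rightarrow> (real^'d \<Rightarrow> real) \<Rightarrow> (real^'d) set" where
  "grad_space r f = span (grad_on (cball 0 r) f ` cball 0 r)"

definition grad_matrix :: "real \<Rightarrow> (real^'d \<Rightarrow> real) \<Rightarrow> ('n \<Rightarrow> real^'d) \<Rightarrow> real^'n^'d" where
  "grad_matrix r f x = (\<chi> i j. grad_on (cball 0 r) f (x j) $ i)"

definition rotated :: "(real^'d \<Rightarrow> real) \<Rightarrow> real^'d^'d \<Rightarrow> real^'d \<Rightarrow> real" where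
  "rotated f W = (\<lambda>x. f (W *v x))"

definition active_vars :: "real \<Rightarrow> (real^'d \<Rightarrow> real) \<Rightarrow> 'd set" where
  "active_vars r f = {i. \<exists>x\<in>cball 0 r. partial_on (cball 0 r) i f x \<noteq> 0}"

text \<open>
  A linear order on a finite index type identifies it with \<open>{0..<n}\<close>: the position of \<open>i\<close> is
  the number of smaller indices. This lets row and column indices of different types be compared.
\<close>

definition index_pos :: "'i::{finite,linorder} \<Rightarrow> nat" where
  "index_pos i = card {k. k < i}"

definition rect_diagonal :: "real^('n::{finite,linorder})^('d::{finite,linorder}) \<Rightarrow> bool" where
  "rect_diagonal S \<longleftrightarrow> (\<forall>i j. index_pos i \<noteq> index_pos j \<longrightarrow> S $ i $ j = 0)"

text \<open>The singular values need not be sorted.\<close>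

definition left_singular_matrix ::
  "real^('n::{finite,linorder})^('d::{finite,linorder}) \<Rightarrow>
   real^('d::{finite,linorder})^('d::{finite,linorder}) \<Rightarrow> bool" where
  "left_singular_matrix B U \<longleftrightarrow> orthogonal_matrix U \<and>
     (\<exists>S W. orthogonal_matrix W \<and> rect_diagonal S \<and> (\<forall>i j. 0 \<le> S $ i $ j) \<and>
        B = U ** S ** transpose W)"

end

theory Submission
  imports Defs
begin

text \<open>
  By the chain rule the \<open>i\<close>-th partial derivative of \<open>f \<circ> W\<close> at \<open>x\<close> is the inner product of the
  \<open>i\<close>-th column of \<open>W\<close> with the gradient of \<open>f\<close> at \<open>W x\<close>, and \<open>W\<close> permutes the ball. So the active
  variables of \<open>f \<circ> W\<close> are the columns of \<open>W\<close> that are not orthogonal to the gradient space \<open>V\<close>.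
  Those columns span a space containing \<open>V\<close>, so there are at least \<open>dim V\<close> of them. If \<open>U\<close> is a left
  singular matrix of \<open>B\<close>, a column of \<open>U\<close> not orthogonal to the column space \<open>V\<close> of \<open>B\<close> belongs to a
  nonzero singular value and hence lies in \<open>V\<close>; these columns are orthonormal, so there are at most
  \<open>dim V\<close> of them.
\<close>

text \<open>Makes the chain rule usable at boundary points of the ball. Uniqueness of one-sided
  derivatives along segments from \<open>x\<close> into \<open>S\<close> gives agreement on all
  \<open>y - x\<close> with \<open>y \<in> S\<close>. Since \<open>S\<close> has interior,
  differences of such vectors reach every direction up to scaling.\<close>

lemma has_derivative_within_convex_unique:
  fixes f :: "'a::real_normed_vector \<Rightarrow> 'b::real_normed_vector"
  assumes f': "(f has_derivative f') (at x within S)"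
    and f'': "(f has_derivative f'') (at x within S)"
    and S: "convex S" "x \<in> S" "interior S \<noteq> {}"
  shows "f' = f''"
proof
  fix v
  interpret f': bounded_linear f' using f' by (rule has_derivative_bounded_linear)
  interpret f'': bounded_linear f'' using f'' by (rule has_derivative_bounded_linear)
  have segment: "f' (y - x) = f'' (y - x)" if "y \<in> S" for y
  proof -
    let ?g = "\<lambda>t::real. x + t *\<^sub>R (y - x)"
    have sub: "?g ` {0..1} \<subseteq> S"
    proof clarify
      fix t :: real
      assume "t \<in> {0..1}"
      then have "(1 - t) *\<^sub>R x + t *\<^sub>R y \<in> S"
        using S(1,2) that by (intro convexD_alt) auto
      then show "?g t \<in> S"
        by (simp add: algebra_simps)
    qed
    have g: "(?g has_derivative (\<lambda>t. t *\<^sub>R (y - x))) (at 0 within {0..1})"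
      by (auto intro!: derivative_eq_intros)
    have "((f \<circ> ?g) has_vector_derivative D (y - x)) (at 0 within {0..1})"
      if D: "(f has_derivative D) (at x within S)" for D
    proof -
      have "(f has_derivative D) (at (?g 0) within ?g ` {0..1})"
        using has_derivative_subset[OF D sub] by simp
      from diff_chain_within[OF g this]
      show ?thesis
        using bounded_linear.linear[OF has_derivative_bounded_linear[OF D]]
        by (simp add: has_vector_derivative_def comp_def linear_cmul)
    qed
    then show ?thesis
      using vector_derivative_unique_within_closed_interval[of 0 1 0 "f \<circ> ?g"] f' f'' by auto
  qed
  obtain c e where e: "e > 0" "ball c e \<subseteq> S"
    using S(3) mem_interior by blast
  show "f' v = f'' v"
  proof (cases "v = 0")
    case False
    \<comment> \<open>This scales \<open>v\<close> to length \<open>e / 2\<close>, so that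
      \<open>c + t *\<^sub>R v\<close> stays in the ball around \<open>c\<close>.\<close>
    define t where "t = e / (2 * norm v)"
    have t: "t > 0" "c + t *\<^sub>R v \<in> S"
      using e False by (auto simp: t_def dist_norm intro!: subsetD[OF e(2)])
    have "c \<in> S" using e by auto
    have "f' (t *\<^sub>R v) = f' (c + t *\<^sub>R v - x) - f' (c - x)"
      by (simp flip: f'.diff)
    also have "\<dots> = f'' (c + t *\<^sub>R v - x) - f'' (c - x)"
      using segment t(2) \<open>c \<in> S\<close> by simp
    also have "\<dots> = f'' (t *\<^sub>R v)"
      by (simp flip: f''.diff)
    finally show ?thesis
      using t(1) by (simp add: f'.scaleR f''.scaleR)
  qed simp
qed

lemma frechet_derivative_eq_inner_grad_on:
  assumes "f differentiable (at x within S)"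
  shows "frechet_derivative f (at x within S) v = v \<bullet> grad_on S f x"
proof -
  let ?D = "frechet_derivative f (at x within S)"
  have "linear ?D"
    using assms linear_frechet_derivative by blast
  then have "?D (\<Sum>i\<in>UNIV. (v $ i) *s axis i 1) = (\<Sum>i\<in>UNIV. v $ i * ?D (axis i 1))"
    by (simp add: linear_sum scalar_mult_eq_scaleR linear_cmul)
  then show ?thesis
    by (simp add: basis_expansion grad_on_def partial_on_def inner_vec_def)
qed

lemma orthogonal_matrix_image_cball:
  fixes W :: "real^'d^'d"
  assumes "orthogonal_matrix W"
  shows "(*v) W ` cball 0 r = cball 0 r"
  using assms by (intro image_orthogonal_transformation_cball[of "(*v) W" 0, simplified])
    (simp add: orthogonal_transformation_matrix)

lemma partial_on_rotated:
  fixes f :: "real^'d \<Rightarrow> real"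
  assumes "r > 0" "f differentiable_on cball 0 r" "orthogonal_matrix W" "x \<in> cball 0 r"
  shows "partial_on (cball 0 r) i (rotated f W) x = column i W \<bullet> grad_on (cball 0 r) f (W *v x)"
proof -
  let ?S = "cball 0 r :: (real^'d) set"
  let ?D = "frechet_derivative f (at (W *v x) within ?S)"
  have W: "(*v) W ` ?S = ?S"
    using assms(3) by (rule orthogonal_matrix_image_cball)
  then have "W *v x \<in> ?S"
    using assms(4) by blast
  then have diff: "f differentiable (at (W *v x) within ?S)"
    using assms(2) differentiable_onD by blast
  then have "(f has_derivative ?D) (at (W *v x) within (*v) W ` ?S)"
    by (simp add: W frechet_derivative_works)
  moreover have "((*v) W has_derivative (*v) W) (at x within ?S)"
    by (simp add: bounded_linear_imp_has_derivative)
  ultimately have der: "(rotated f W has_derivative ?D \<circ> (*v) W) (at x within ?S)"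
    using diff_chain_within by (fastforce simp: rotated_def comp_def)
  then have "(rotated f W has_derivative frechet_derivative (rotated f W) (at x within ?S))
      (at x within ?S)"
    using differentiableI frechet_derivative_works by blast
  \<comment> \<open>\<open>frechet_derivative\<close> is merely some chosen derivative; uniqueness
    on the ball identifies it with the one from the chain rule.\<close>
  then have "frechet_derivative (rotated f W) (at x within ?S) = ?D \<circ> (*v) W"
    using der assms(1,4) by (intro has_derivative_within_convex_unique[where S = ?S]) auto
  then show ?thesis
    by (simp add: partial_on_def frechet_derivative_eq_inner_grad_on[OF diff]
        matrix_vector_mult_basis)
qed

lemma active_vars_rotated:
  fixes f :: "real^'d \<Rightarrow> real"
  assumes "r > 0" "f differentiable_on cball 0 r" "orthogonal_matrix W"
  shows "active_vars r (rotated f W) = {i. \<exists>v\<in>grad_space r f. column i W \<bullet> v \<noteq> 0}"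
proof -
  let ?S = "cball 0 r :: (real^'d) set"
  have "i \<in> active_vars r (rotated f W) \<longleftrightarrow>
      (\<exists>y\<in>(*v) W ` ?S. column i W \<bullet> grad_on ?S f y \<noteq> 0)" for i
    using partial_on_rotated[OF assms] by (simp add: active_vars_def)
  \<comment> \<open>A vector orthogonal to all gradients is orthogonal to their span.\<close>
  moreover have "(\<exists>y\<in>?S. column i W \<bullet> grad_on ?S f y \<noteq> 0) \<longleftrightarrow>
      (\<exists>v\<in>grad_space r f. column i W \<bullet> v \<noteq> 0)" for i
    unfolding grad_space_def
    using orthogonal_to_span[of _ "grad_on ?S f ` ?S" "column i W"]
    by (auto simp: orthogonal_def intro: span_base)
  ultimately show ?thesis
    by (auto simp: orthogonal_matrix_image_cball[OF assms(3)])
qed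

lemma inner_columns_orthogonal_matrix:
  fixes W :: "real^'d^'d"
  assumes "orthogonal_matrix W"
  shows "column i W \<bullet> column j W = (if i = j then 1 else 0)"
  using assms by (auto simp: orthogonal_matrix_orthonormal_columns orthogonal_def norm_eq_1)

text \<open>This is \<open>W ** transpose W = mat 1\<close> applied to \<open>v\<close> and read
  column by column.\<close>

lemma orthogonal_matrix_expansion:
  fixes W :: "real^'d^'d"
  assumes "orthogonal_matrix W"
  shows "(\<Sum>i\<in>UNIV. (column i W \<bullet> v) *\<^sub>R column i W) = v"
proof -
  have "W *v (transpose W *v v) = v"
    using assms
    by (simp add: matrix_vector_mul_assoc orthogonal_matrix_def del: transpose_matrix_vector)
  moreover have "(transpose W *v v) $ i = column i W \<bullet> v" for i
    by (simp add: matrix_vector_mult_def transpose_def column_def inner_vec_def)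
  ultimately show ?thesis
    by (simp add: matrix_mult_sum[of W] scalar_mult_eq_scaleR)
qed

text \<open>In the orthonormal expansion of any \<open>v \<in> V\<close>, the columns outside the
  index set have coefficient 0, so those inside it already span \<open>V\<close>.\<close>

lemma dim_le_card_nonorthogonal_columns:
  fixes W :: "real^'d^'d"
  assumes "orthogonal_matrix W"
  shows "dim V \<le> card {i. \<exists>v\<in>V. column i W \<bullet> v \<noteq> 0}"
proof -
  let ?I = "{i. \<exists>v\<in>V. column i W \<bullet> v \<noteq> 0}"
  have "v \<in> span ((\<lambda>i. column i W) ` ?I)" if "v \<in> V" for v
  proof -
    have "(\<Sum>i\<in>UNIV. (column i W \<bullet> v) *\<^sub>R column i W) \<in> span ((\<lambda>i. column i W) ` ?I)"
    proof (rule span_sum)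
      fix i
      show "(column i W \<bullet> v) *\<^sub>R column i W \<in> span ((\<lambda>i. column i W) ` ?I)"
        using that by (cases "column i W \<bullet> v = 0")
          (auto intro!: span_zero span_scale intro: span_base)
    qed
    then show ?thesis
      by (simp add: orthogonal_matrix_expansion[OF assms])
  qed
  then have "dim V \<le> card ((\<lambda>i. column i W) ` ?I)"
    by (intro dim_le_card) auto
  also have "\<dots> \<le> card ?I"
    by (simp add: card_image_le)
  finally show ?thesis .
qed

text \<open>Orthonormality makes the columns distinct and independent, so counting indices counts
  independent vectors in \<open>V\<close>.\<close>

lemma card_columns_le_dim:
  fixes U :: "real^'d^'d"
  assumes "orthogonal_matrix U" "\<And>i. i \<in> I \<Longrightarrow> column i U \<in> V"
  shows "card I \<le> dim V"
proof -
  note inner = inner_columns_orthogonal_matrix[OF assms(1)]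
  let ?C = "(\<lambda>i. column i U) ` I"
  have "column i U \<noteq> column j U" if "i \<noteq> j" for i j
    using inner[of i j] inner[of j j] that by auto
  then have "inj_on (\<lambda>i. column i U) I"
    by (auto intro: inj_onI)
  have "column i U \<noteq> 0" for i
    using inner[of i i] by auto
  then have "0 \<notin> ?C"
    by (metis imageE)
  moreover have "pairwise orthogonal ?C"
    by (auto simp: pairwise_def orthogonal_def inner)
  ultimately have "independent ?C"
    by (intro pairwise_orthogonal_independent)
  then have "card ?C \<le> dim V"
    using assms(2) by (intro independent_card_le_dim) auto
  then show ?thesis
    using \<open>inj_on (\<lambda>i. column i U) I\<close> by (simp add: card_image)
qed

lemma inj_index_pos: "inj (index_pos :: 'i::{finite,linorder} \<Rightarrow> nat)"
proof (rule linorder_injI)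
  fix i j :: 'i
  assume "i < j"
  then have "{k. k < i} \<subset> {k. k < j}" by auto
  then show "index_pos i \<noteq> index_pos j"
    unfolding index_pos_def by (metis finite less_irrefl psubset_card_mono)
qed

lemma left_singular_column_in_column_space:
  assumes "left_singular_matrix B U" "v \<in> span (columns B)" "column i U \<bullet> v \<noteq> 0"
  shows "column i U \<in> span (columns B)"
proof -
  obtain S W where U: "orthogonal_matrix U" and W: "orthogonal_matrix W"
    and diag: "rect_diagonal S" and B: "B = U ** S ** transpose W"
    using assms(1) unfolding left_singular_matrix_def by blast
  obtain j where j: "column i U \<bullet> column j B \<noteq> 0"
    using orthogonal_to_span[OF assms(2), of "column i U"] assms(3)
    by (auto simp: orthogonal_def columns_def)
  \<comment> \<open>Entry \<open>(i, j)\<close> on the left is the nonzero inner product found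
    above, so row \<open>i\<close> of \<open>S\<close> cannot vanish.\<close>
  have "transpose U ** B = S ** transpose W"
    using U by (simp add: B matrix_mul_assoc orthogonal_matrix_def)
  moreover have "(transpose U ** B) $ i $ j = column i U \<bullet> column j B"
    by (simp add: matrix_matrix_mult_def transpose_def column_def inner_vec_def)
  ultimately have "(\<Sum>k\<in>UNIV. S $ i $ k * transpose W $ k $ j) \<noteq> 0"
    using j by (simp add: matrix_matrix_mult_def)
  then obtain k where k: "S $ i $ k \<noteq> 0"
    by (rule sum.not_neutral_contains_not_neutral) auto
  then have pos: "index_pos i = index_pos k"
    using diag unfolding rect_diagonal_def by blast
  \<comment> \<open>Injectivity of \<open>index_pos\<close> leaves row \<open>i\<close> as the only
    place where column \<open>k\<close> of \<open>S\<close> can be nonzero.\<close>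
  have "column k S = S $ i $ k *s axis i 1"
  proof -
    have "S $ l $ k = 0" if "l \<noteq> i" for l
      using that diag by (simp add: rect_diagonal_def inj_eq[OF inj_index_pos] flip: pos)
    then show ?thesis
      by (auto simp: vec_eq_iff column_def axis_def)
  qed
  \<comment> \<open>Applied to the basis vector of index \<open>k\<close>, this exhibits a nonzero
    multiple of column \<open>i\<close> of \<open>U\<close> as a value of \<open>B\<close>.\<close>
  moreover have "B ** W = U ** S"
    using W by (simp add: B orthogonal_matrix_def flip: matrix_mul_assoc)
  then have "B *v (W *v axis k 1) = U *v (S *v axis k 1)"
    by (simp add: matrix_vector_mul_assoc)
  ultimately have "B *v (W *v axis k 1) = S $ i $ k *\<^sub>R column i U"
    by (simp add: matrix_vector_mult_basis vector_scalar_commute scalar_mult_eq_scaleR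
        matrix_vector_mult_scaleR)
  then have "S $ i $ k *\<^sub>R column i U \<in> span (columns B)"
    using matrix_vector_mult_in_columnspace[of B "W *v axis k 1"] by simp
  then show ?thesis
    using k span_scale[of "S $ i $ k *\<^sub>R column i U" "columns B" "inverse (S $ i $ k)"] by simp
qed

theorem proposition3p3:
  fixes r :: real
    and f :: "real^('d::{finite,linorder}) \<Rightarrow> real"
    and x :: "'n::{finite,linorder} \<Rightarrow> real^('d::{finite,linorder})"
    and U :: "real^('d::{finite,linorder})^('d::{finite,linorder})"
  assumes "r > 0"
    and "C1_on (cball 0 r) f"
    and "\<And>j. x j \<in> cball 0 r"
    and "span (columns (grad_matrix r f x)) = grad_space r f"
    and "left_singular_matrix (grad_matrix r f x) U"
  shows "is_arg_min (\<lambda>W. card (active_vars r (rotated f W))) orthogonal_matrix U"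
proof -
  have f: "f differentiable_on cball 0 r"
    using assms(2) by (simp add: C1_on_def)
  note active = active_vars_rotated[OF assms(1) f]
  have U: "orthogonal_matrix U"
    using assms(5) by (simp add: left_singular_matrix_def)
  \<comment> \<open>The spanning hypothesis turns the column space of \<open>B\<close> into the
    gradient space.\<close>
  have "card (active_vars r (rotated f U)) \<le> dim (grad_space r f)"
    using left_singular_column_in_column_space[OF assms(5)]
    by (intro card_columns_le_dim[OF U]) (auto simp: active[OF U] assms(4))
  moreover have "dim (grad_space r f) \<le> card (active_vars r (rotated f W))"
    if "orthogonal_matrix W" for W
    using dim_le_card_nonorthogonal_columns[OF that] by (simp add: active[OF that])
  ultimately show ?thesis
    using U by (fastforce simp: is_arg_min_def)
qed

end
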